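(* Let $V\subset\mathbb{C}^n$ be a complex subspace, $T\in GL(V)$, and let $\beta=(v_1,\ldots,v_p)$ be a basis of $V$ in which $T$ has Jordan normal form, with eigenvalues $\lambda_1,\ldots,\lambda_p$ in its diagonal. Then: (i) $T$ is a composition of complex shears, complex line scalings and phase rotations by $\varphi_j=\arg(\lambda_j)$ of the complex lines $\mathbb{C}v_j$ ($1\le j\le p$), and $\arg(\det T)=\sum_{j=1}^p\varphi_j\pmod{2\pi}$. (ii) $T$ is a composition of complex shears, complex line scalings and a single phase rotation by $\varphi=\arg(\det T)$. (iii) $T\in GL^+(V)$ if and only if $T$ is a composition of complex shears and complex line scalings.
   Context: $GL^+(V)=\{T\in GL(V):\det T>0\}$ (meaning $\det T$ is a positive real number). A transformation $S\in GL(V)$ is called: - a complex shear, if it maps some basis $(w_1,w_2,\ldots,w_p)$ of $V$ to $(w_1+u,w_2,\ldots,w_p)$ for some $u\in\operatorname{span}_{\mathbb{C}}\{w_2,\ldots,w_p\}$; - a complex line scaling, if it maps some basis $(w_1,w_2,\ldots,w_p)$ of $V$ to $(cw_1,w_2,\ldots,w_p)$ for some real $c>0$; - a phase rotation (by $\varphi$, of the complex line $\mathbb{C}w_1$), if it maps some basis $(w_1,w_2,\ldots,w_p)$ of $V$ to $(e^{\mathrm{i}\varphi}w_1,w_2,\ldots,w_p)$ for some $\varphi\in[0,2\pi)$. In (i), the phase rotation of $\mathbb{C}v_j$ by $\varphi_j$ is the one that maps $v_j$ to $e^{\mathrm{i}\varphi_j}v_j$ and fixes the other vectors of $\beta$.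 *)

theory Defs
  imports
    "HOL-Analysis.Analysis"
    "HOL-Library.Real_Mod"
    "Jordan_Normal_Form.Jordan_Normal_Form"
begin

(* An endomorphism of a subspace V of C^n is a function on all of C^n of which only the
   values on V matter. *)
definition GL :: "(complex ^ 'n) set \<Rightarrow> (complex ^ 'n \<Rightarrow> complex ^ 'n) set" where
  "GL V = {T. (\<forall>x\<in>V. \<forall>y\<in>V. T (x + y) = T x + T y) \<and>
              (\<forall>c. \<forall>x\<in>V. T (c *s x) = c *s T x) \<and> bij_betw T V V}"

definition ordered_basis :: "(complex ^ 'n) set \<Rightarrow> (complex ^ 'n) list \<Rightarrow> bool" where
  "ordered_basis V ws \<longleftrightarrow> distinct ws \<and> vec.independent (set ws) \<and> vec.span (set ws) = V"

definition matrix_wrt ::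
  "(complex ^ 'n) list \<Rightarrow> (complex ^ 'n \<Rightarrow> complex ^ 'n) \<Rightarrow> complex mat" where
  "matrix_wrt ws T = Matrix.mat (length ws) (length ws)
     (\<lambda>(i, j). vec.representation (set ws) (T (ws ! j)) (ws ! i))"

(* The determinant is computed in an arbitrarily chosen basis of V. *)
definition det_on :: "(complex ^ 'n) set \<Rightarrow> (complex ^ 'n \<Rightarrow> complex ^ 'n) \<Rightarrow> complex" where
  "det_on V T = Determinant.det (matrix_wrt (SOME ws. ordered_basis V ws) T)"

definition GL_plus :: "(complex ^ 'n) set \<Rightarrow> (complex ^ 'n \<Rightarrow> complex ^ 'n) set" where
  "GL_plus V = {T \<in> GL V. \<exists>r>0. det_on V T = complex_of_real r}"

definition complex_shear ::
  "(complex ^ 'n) set \<Rightarrow> (complex ^ 'n \<Rightarrow> complex ^ 'n) \<Rightarrow> bool" where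
  "complex_shear V S \<longleftrightarrow> S \<in> GL V \<and>
     (\<exists>w ws u. ordered_basis V (w # ws) \<and> u \<in> vec.span (set ws) \<and>
        map S (w # ws) = (w + u) # ws)"

definition complex_line_scaling ::
  "(complex ^ 'n) set \<Rightarrow> (complex ^ 'n \<Rightarrow> complex ^ 'n) \<Rightarrow> bool" where
  "complex_line_scaling V S \<longleftrightarrow> S \<in> GL V \<and>
     (\<exists>w ws c. ordered_basis V (w # ws) \<and> c > 0 \<and>
        map S (w # ws) = (complex_of_real c *s w) # ws)"

definition phase_rotation ::
  "(complex ^ 'n) set \<Rightarrow> real \<Rightarrow> (complex ^ 'n \<Rightarrow> complex ^ 'n) \<Rightarrow> bool" where
  "phase_rotation V \<phi> S \<longleftrightarrow> S \<in> GL V \<and> 0 \<le> \<phi> \<and> \<phi> < 2 * pi \<and>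
     (\<exists>w ws. ordered_basis V (w # ws) \<and>
        map S (w # ws) = (exp (\<i> * complex_of_real \<phi>) *s w) # ws)"

(* The phase rotation by \<phi> of the line spanned by the entry of the basis ws at the
   position j, counted from 0; the other entries of ws are fixed. *)
definition basis_phase_rotation ::
  "(complex ^ 'n) set \<Rightarrow> (complex ^ 'n) list \<Rightarrow> nat \<Rightarrow> real \<Rightarrow> (complex ^ 'n \<Rightarrow> complex ^ 'n) \<Rightarrow> bool"
where
  "basis_phase_rotation V ws j \<phi> S \<longleftrightarrow> S \<in> GL V \<and> 0 \<le> \<phi> \<and> \<phi> < 2 * pi \<and>
     ordered_basis V ws \<and> j < length ws \<and>
     map S ws = ws[j := exp (\<i> * complex_of_real \<phi>) *s (ws ! j)]"

(* On V, T is a finite composition, in some order, of the maps listed in rs (each used exactly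
   once) and of any number, possibly zero, of complex shears and complex line scalings.
   The empty composition is the identity. *)
definition composed_of_shears_scalings_and ::
  "(complex ^ 'n) set \<Rightarrow> (complex ^ 'n \<Rightarrow> complex ^ 'n) list \<Rightarrow> (complex ^ 'n \<Rightarrow> complex ^ 'n) \<Rightarrow> bool"
where
  "composed_of_shears_scalings_and V rs T \<longleftrightarrow>
     (\<exists>gs fs. (\<forall>g\<in>set gs. complex_shear V g \<or> complex_line_scaling V g) \<and>
        mset fs = mset gs + mset rs \<and> (\<forall>x\<in>V. T x = foldr (\<circ>) fs id x))"

(* The blocks of jordan_matrix have their ones above the diagonal. *)
definition jordan_basis ::
  "(complex ^ 'n) set \<Rightarrow> (complex ^ 'n \<Rightarrow> complex ^ 'n) \<Rightarrow> (complex ^ 'n) list \<Rightarrow> bool" where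
  "jordan_basis V T ws \<longleftrightarrow> ordered_basis V ws \<and>
     (\<exists>n_as. 0 \<notin> fst ` set n_as \<and> matrix_wrt ws T = jordan_matrix n_as)"

end

theory Submission
  imports Defs
begin

text \<open>
  A Jordan matrix is upper triangular, and an upper triangular automorphism can be built one
  column at a time. Let \<open>H\<^sub>k\<close> fix all vectors of the basis \<open>v\<^sub>1, \<dots>, v\<^sub>p\<close> except \<open>v\<^sub>k\<close>, which it sends to
  \<open>T v\<^sub>k = \<lambda>\<^sub>k v\<^sub>k + u\<^sub>k\<close> with \<open>u\<^sub>k\<close> in the span of the earlier vectors. Then
  \<open>T = H\<^sub>p \<circ> \<dots> \<circ> H\<^sub>1\<close>, because each \<open>H\<^sub>k\<close> leaves the columns that were built before it alone.
  Moreover \<open>H\<^sub>k\<close> is the phase rotation by the argument of \<open>\<lambda>\<^sub>k\<close>, followed by the scaling by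
  the modulus of \<open>\<lambda>\<^sub>k\<close>, followed by the shear adding \<open>u\<^sub>k / \<lambda>\<^sub>k\<close> to \<open>v\<^sub>k\<close>. This is the
  decomposition in (i) (\<open>triangular_composed_columnwise\<close>). Since the determinant is the product
  of the diagonal, its argument is the sum of the \<open>\<phi>\<^sub>j\<close> modulo \<open>2\<pi>\<close>.

  For (iii), shears have determinant 1 and line scalings have positive determinant, so a
  composition of them has positive determinant. Conversely, let the determinant be positive.
  If all diagonal entries are positive, the rotations above are trivial. In general, the map
  multiplying one basis vector by \<open>\<mu>\<close> and another one by \<open>1 / \<mu>\<close> is a product of four shears
  (\<open>reciprocal_scalings_composed\<close>). Multiplying by such maps replaces the diagonal entries by 1, one
  after the other, at the cost of the first entry, which ends up positive because the determinant
  is (\<open>triangular_positive_det_composed\<close>).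

  Finally, (ii) follows from (iii): if \<open>R\<close> is the rotation of the first basis line by the argument
  of the determinant of \<open>T\<close>, then \<open>T \<circ> R\<^sup>-\<^sup>1\<close> is again triangular and has positive determinant.
\<close>

section \<open>Automorphisms and bases of a subspace\<close>

lemma GL_D:
  assumes "T \<in> GL V"
  shows GL_add: "x \<in> V \<Longrightarrow> y \<in> V \<Longrightarrow> T (x + y) = T x + T y"
    and GL_scale: "x \<in> V \<Longrightarrow> T (c *s x) = c *s T x"
    and GL_closed: "x \<in> V \<Longrightarrow> T x \<in> V"
  using assms by (auto simp: GL_def bij_betw_def)

lemma id_in_GL: "id \<in> GL V"
  by (auto simp: GL_def)

lemma GL_comp: "S \<in> GL V \<Longrightarrow> T \<in> GL V \<Longrightarrow> S \<circ> T \<in> GL V"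
  by (auto simp: GL_def bij_betw_trans bij_betwE)

lemma GL_foldr: "(\<And>f. f \<in> set fs \<Longrightarrow> f \<in> GL V) \<Longrightarrow> foldr (\<circ>) fs id \<in> GL V"
  by (induction fs) (auto intro: id_in_GL GL_comp)

lemma inv_into_in_GL:
  assumes V: "vec.subspace V" and T: "T \<in> GL V"
  shows "inv_into V T \<in> GL V"
proof -
  have bij: "bij_betw T V V" using T by (auto simp: GL_def)
  have inj: "inj_on T V" and surj: "T ` V = V" using bij by (auto simp: bij_betw_def)
  have r: "T (inv_into V T x) = x" "inv_into V T x \<in> V" if "x \<in> V" for x
    using that surj by (auto simp: f_inv_into_f inv_into_into)
  have "inv_into V T (x + y) = inv_into V T x + inv_into V T y" if "x \<in> V" "y \<in> V" for x y
    by (rule inv_into_f_eq[OF inj])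
      (use r that GL_add[OF T] vec.subspace_add[OF V] in auto)
  moreover have "inv_into V T (c *s x) = c *s inv_into V T x" if "x \<in> V" for c x
    by (rule inv_into_f_eq[OF inj])
      (use r that GL_scale[OF T] vec.subspace_scale[OF V] in auto)
  ultimately show ?thesis
    using bij_betw_inv_into[OF bij] by (auto simp: GL_def)
qed

lemma ordered_basisD:
  assumes "ordered_basis V ws"
  shows "distinct ws" "vec.independent (set ws)" "vec.span (set ws) = V" "vec.subspace V"
    "w \<in> set ws \<Longrightarrow> w \<in> V" "j < length ws \<Longrightarrow> ws ! j \<in> V"
  using assms by (auto simp: ordered_basis_def vec.span_base)

lemma ordered_basis_cong_set:
  "ordered_basis V ws \<Longrightarrow> distinct us \<Longrightarrow> set us = set ws \<Longrightarrow> ordered_basis V us"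
  by (auto simp: ordered_basis_def)

lemma ordered_basis_exists:
  assumes "vec.subspace V"
  obtains ws where "ordered_basis V ws"
proof -
  obtain B where B: "B \<subseteq> V" "vec.independent B" "V \<subseteq> vec.span B"
    by (rule vec.basis_exists)
  then have "finite B" by (simp add: vec.finiteI_independent)
  then obtain ws where "set ws = B" "distinct ws"
    using finite_distinct_list by blast
  with B assms vec.span_minimal[of B V] have "ordered_basis V ws"
    by (auto simp: ordered_basis_def)
  then show ?thesis ..
qed

lemma length_ordered_basis:
  assumes "ordered_basis V us" "ordered_basis V ws"
  shows "length us = length ws"
proof -
  have "vec.dim V = length bs" if "ordered_basis V bs" for bs
    using vec.dim_eq_card[of "set bs" V] ordered_basisD[OF that] distinct_card[of bs]
    by (metis vec.span_eq_iff)
  then show ?thesis using assms by metis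
qed

text \<open>
  Membership in \<open>GL V\<close> constrains a map only on \<open>V\<close>, so this is the form in which two maps
  are compared: they agree on \<open>V\<close> but may differ outside it.
\<close>

lemma GL_eqI:
  assumes ws: "ordered_basis V ws" and S: "S \<in> GL V" and T: "T \<in> GL V"
    and eq: "\<And>w. w \<in> set ws \<Longrightarrow> S w = T w" and x: "x \<in> V"
  shows "S x = T x"
proof -
  have V: "vec.subspace V" using ordered_basisD[OF ws] by simp
  have z: "S 0 = 0" "T 0 = 0"
    using GL_scale[OF S vec.subspace_0[OF V], of 0] GL_scale[OF T vec.subspace_0[OF V], of 0] by auto
  have "vec.subspace {x \<in> V. S x = T x}"
    using V z by (auto simp: vec.subspace_def GL_add[OF S] GL_add[OF T] GL_scale[OF S] GL_scale[OF T])
  moreover have "set ws \<subseteq> {x \<in> V. S x = T x}"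
    using eq ordered_basisD[OF ws] by auto
  ultimately have "vec.span (set ws) \<subseteq> {x \<in> V. S x = T x}"
    by (intro vec.span_minimal)
  then show ?thesis using x ordered_basisD[OF ws] by auto
qed

lemma representation_list:
  assumes ws: "ordered_basis V ws" and x: "x \<in> V"
  shows "(\<Sum>i<length ws. vec.representation (set ws) x (ws ! i) *s (ws ! i)) = x"
proof -
  have "(\<Sum>b\<in>set ws. vec.representation (set ws) x b *s b) = x"
    using vec.sum_representation_eq[of "set ws" x "set ws"] ordered_basisD[OF ws] x by auto
  also have "(\<Sum>b\<in>set ws. vec.representation (set ws) x b *s b) =
     (\<Sum>i<length ws. vec.representation (set ws) x (ws ! i) *s (ws ! i))"
    using sum.reindex_bij_betw[OF bij_betw_nth[OF ordered_basisD(1)[OF ws] refl refl], symmetric] .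
  finally show ?thesis .
qed

lemma GL_sum:
  assumes V: "vec.subspace V" and T: "T \<in> GL V" and f: "\<And>i. i \<in> I \<Longrightarrow> f i \<in> V"
  shows "T (\<Sum>i\<in>I. f i) = (\<Sum>i\<in>I. T (f i))"
proof -
  have z: "T 0 = 0" using GL_scale[OF T vec.subspace_0[OF V], of 0] by auto
  show ?thesis using f
  proof (induction I rule: infinite_finite_induct)
    case (insert i I)
    then have "(\<Sum>i\<in>I. f i) \<in> V" using V by (auto intro: vec.subspace_sum)
    with insert show ?case by (simp add: GL_add[OF T])
  qed (auto simp: z)
qed

section \<open>The determinant of an automorphism\<close>

text \<open>
  Matrices between two bases make the change-of-basis matrix the matrix of the identity, so
  that one multiplication rule yields both multiplicativity and basis independence of the
  determinant.
\<close>

definition matrix_between ::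
  "(complex ^ 'n) list \<Rightarrow> (complex ^ 'n) list \<Rightarrow> (complex ^ 'n \<Rightarrow> complex ^ 'n) \<Rightarrow> complex mat" where
  "matrix_between us ws T = Matrix.mat (length ws) (length us)
     (\<lambda>(i, j). vec.representation (set ws) (T (us ! j)) (ws ! i))"

lemma matrix_between_same: "matrix_between ws ws T = matrix_wrt ws T"
  by (simp add: matrix_between_def matrix_wrt_def)

lemma matrix_between_comp:
  assumes us: "ordered_basis V us" and vs: "ordered_basis V vs" and ws: "ordered_basis V ws"
    and S: "S \<in> GL V" and T: "T \<in> GL V"
  shows "matrix_between us ws (S \<circ> T) = matrix_between vs ws S * matrix_between us vs T"
proof (rule eq_matI)
  fix i j
  assume "i < dim_row (matrix_between vs ws S * matrix_between us vs T)"
    and "j < dim_col (matrix_between vs ws S * matrix_between us vs T)"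
  then have i: "i < length ws" and j: "j < length us" by (auto simp: matrix_between_def)
  define r where "r = vec.representation (set vs) (T (us ! j))"
  have V: "vec.subspace V" using ordered_basisD[OF us] by simp
  have vsV: "vs ! k \<in> V" if "k < length vs" for k using ordered_basisD[OF vs] that by auto
  have Tu: "T (us ! j) \<in> V" using GL_closed[OF T] ordered_basisD[OF us] j by auto
  have "S (T (us ! j)) = S (\<Sum>k<length vs. r (vs ! k) *s (vs ! k))"
    using representation_list[OF vs Tu] by (simp add: r_def)
  also have "\<dots> = (\<Sum>k<length vs. r (vs ! k) *s S (vs ! k))"
    using vsV V by (subst GL_sum[OF V S]) (auto simp: GL_scale[OF S] vec.subspace_scale)
  finally have STu: "S (T (us ! j)) = (\<Sum>k<length vs. r (vs ! k) *s S (vs ! k))" .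
  have SvV: "S (vs ! k) \<in> vec.span (set ws)" if "k \<in> {..<length vs}" for k
    using ordered_basisD[OF ws] vsV GL_closed[OF S] that by auto
  have "vec.representation (set ws) (S (T (us ! j))) (ws ! i) =
      (\<Sum>k<length vs. r (vs ! k) * vec.representation (set ws) (S (vs ! k)) (ws ! i))"
    unfolding STu using ordered_basisD(2)[OF ws] SvV
    by (subst vec.representation_sum) (auto simp: vec.representation_scale vec.span_scale)
  then show "matrix_between us ws (S \<circ> T) $$ (i, j) =
      (matrix_between vs ws S * matrix_between us vs T) $$ (i, j)"
    using i j by (simp add: matrix_between_def scalar_prod_def r_def lessThan_atLeast0 mult.commute)
qed (auto simp: matrix_between_def)

lemma matrix_wrt_id:
  assumes "ordered_basis V ws"
  shows "matrix_wrt ws id = 1\<^sub>m (length ws)"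
  using ordered_basisD[OF assms]
  by (intro eq_matI) (auto simp: matrix_wrt_def vec.representation_basis nth_eq_iff_index_eq)

text \<open>
  The matrices of the identity from one basis to the other are mutually inverse, and they
  conjugate the two matrices of \<open>T\<close> into each other.
\<close>

lemma det_matrix_wrt_basis_independent:
  assumes us: "ordered_basis V us" and ws: "ordered_basis V ws" and T: "T \<in> GL V"
  shows "Determinant.det (matrix_wrt us T) = Determinant.det (matrix_wrt ws T)"
proof (rule det_similar, rule similar_matI)
  let ?P = "matrix_between ws us id" and ?Q = "matrix_between us ws id"
  have l: "length us = length ws" using length_ordered_basis[OF us ws] .
  show "{matrix_wrt us T, matrix_wrt ws T, ?P, ?Q} \<subseteq> carrier_mat (length ws) (length ws)"
    by (auto simp: matrix_wrt_def matrix_between_def l)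
  show "?P * ?Q = 1\<^sub>m (length ws)"
    using matrix_between_comp[OF us ws us id_in_GL id_in_GL] matrix_wrt_id[OF us]
    by (simp add: matrix_between_same l)
  show "?Q * ?P = 1\<^sub>m (length ws)"
    using matrix_between_comp[OF ws us ws id_in_GL id_in_GL] matrix_wrt_id[OF ws]
    by (simp add: matrix_between_same)
  show "matrix_wrt us T = ?P * matrix_wrt ws T * ?Q"
    using matrix_between_comp[OF ws ws us id_in_GL T] matrix_between_comp[OF us ws us T id_in_GL]
    by (simp add: matrix_between_same)
qed

lemma det_on_eq:
  assumes "ordered_basis V ws" "T \<in> GL V"
  shows "det_on V T = Determinant.det (matrix_wrt ws T)"
  unfolding det_on_def
  using det_matrix_wrt_basis_independent[OF someI[of "ordered_basis V", OF assms(1)] assms] .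

lemma det_on_comp:
  assumes V: "vec.subspace V" and S: "S \<in> GL V" and T: "T \<in> GL V"
  shows "det_on V (S \<circ> T) = det_on V S * det_on V T"
proof -
  obtain ws where ws: "ordered_basis V ws" using ordered_basis_exists[OF V] .
  have "matrix_wrt ws (S \<circ> T) = matrix_wrt ws S * matrix_wrt ws T"
    using matrix_between_comp[OF ws ws ws S T] by (simp add: matrix_between_same)
  then show ?thesis
    by (simp add: det_on_eq[OF ws] S T GL_comp
        det_mult[of _ "length ws"] matrix_wrt_def)
qed

lemma det_on_cong:
  assumes V: "vec.subspace V" and "\<And>x. x \<in> V \<Longrightarrow> S x = T x"
  shows "det_on V S = det_on V T"
proof -
  obtain ws where "ordered_basis V ws" using ordered_basis_exists[OF V] .
  from someI[of "ordered_basis V", OF this]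
  have "S (ws ! j) = T (ws ! j)" if "ws = (SOME ws. ordered_basis V ws)" "j < length ws" for ws j
    using assms(2) ordered_basisD(6) that by metis
  then show ?thesis
    by (auto simp: det_on_def matrix_wrt_def intro!: arg_cong[of _ _ Determinant.det] cong_mat)
qed

lemma det_on_id: "vec.subspace V \<Longrightarrow> det_on V id = 1"
  using ordered_basis_exists[of V] by (metis det_on_eq id_in_GL matrix_wrt_id det_one)

lemma det_on_nonzero:
  assumes V: "vec.subspace V" and T: "T \<in> GL V"
  shows "det_on V T \<noteq> 0"
proof -
  have "T (inv_into V T x) = x" if "x \<in> V" for x
    using T that by (auto simp: GL_def bij_betw_def f_inv_into_f)
  then have "det_on V (T \<circ> inv_into V T) = det_on V id"
    by (intro det_on_cong[OF V]) auto
  then show ?thesis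
    using det_on_comp[OF V T inv_into_in_GL[OF V T]] det_on_id[OF V] by auto
qed

section \<open>Adding a multiple of a vector to one basis vector\<close>

text \<open>
  The map \<open>id + f \<otimes> z\<close>, where \<open>f\<close> is the coordinate functional of the basis vector \<open>w\<close>:
  it sends \<open>w\<close> to \<open>w + z\<close> and fixes the rest of the basis. According to \<open>z\<close> it is a shear, a
  line scaling or a phase rotation, so all three kinds of maps are handled by one formula.
\<close>

definition add_multiple ::
  "(complex ^ 'n) list \<Rightarrow> complex ^ 'n \<Rightarrow> complex ^ 'n \<Rightarrow> complex ^ 'n \<Rightarrow> complex ^ 'n" where
  "add_multiple ws w z x = x + vec.representation (set ws) x w *s z"

lemma add_multiple_basis:
  assumes "ordered_basis V ws" and "v \<in> set ws"
  shows "add_multiple ws w z v = (if v = w then w + z else v)"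
  using ordered_basisD[OF assms(1)] assms(2)
  by (simp add: add_multiple_def vec.representation_basis)

lemma representation_outside_eq_0:
  assumes ws: "ordered_basis V ws" and x: "x \<in> vec.span (set ws - {w})"
  shows "vec.representation (set ws) x w = 0"
proof -
  have "vec.representation (set ws) x = vec.representation (set ws - {w}) x"
    using ordered_basisD[OF ws] x by (intro vec.representation_extend) auto
  then show ?thesis using vec.representation_ne_zero by fastforce
qed

lemma representation_linear:
  assumes ws: "ordered_basis V ws"
  shows "x \<in> V \<Longrightarrow> y \<in> V \<Longrightarrow> vec.representation (set ws) (x + y) w =
      vec.representation (set ws) x w + vec.representation (set ws) y w"
    and "x \<in> V \<Longrightarrow> vec.representation (set ws) (c *s x) w = c * vec.representation (set ws) x w"
  using ordered_basisD[OF ws] by (simp_all add: vec.representation_add vec.representation_scale)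

text \<open>
  A rank-one perturbation of the identity has an inverse of the same shape: applying
  \<open>f\<close> to \<open>x + f x z\<close> gives \<open>(1 + f z) f x\<close>, which recovers \<open>f x\<close> and hence \<open>x\<close>.
\<close>

lemma add_multiple_cancel:
  assumes ws: "ordered_basis V ws" and z: "z \<in> V" and x: "x \<in> V"
    and a: "1 + vec.representation (set ws) z w = a" "a \<noteq> 0"
  shows "add_multiple ws w ((- 1 / a) *s z) (add_multiple ws w z x) = x"
proof -
  note V = ordered_basisD(4)[OF ws]
  define f where "f y = vec.representation (set ws) y w" for y
  have "f (x + f x *s z) = f x * a"
    using z x V a by (simp add: f_def representation_linear[OF ws] vec.subspace_scale algebra_simps flip: a(1))
  then have "add_multiple ws w ((- 1 / a) *s z) (add_multiple ws w z x)
      = x + f x *s z + (f x * a) *s ((- 1 / a) *s z)"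
    by (simp add: add_multiple_def f_def)
  also have "\<dots> = x" using a by (simp add: vector_smult_lneg)
  finally show ?thesis .
qed

lemma add_multiple_in_GL:
  assumes ws: "ordered_basis V ws" and z: "z \<in> V"
    and a: "1 + vec.representation (set ws) z w \<noteq> 0"
  shows "add_multiple ws w z \<in> GL V"
proof -
  note V = ordered_basisD(4)[OF ws]
  define a where "a = 1 + vec.representation (set ws) z w"
  define z' where "z' = (- 1 / a) *s z"
  have z': "z' \<in> V" unfolding z'_def using z V by (rule vec.subspace_scale[rotated])
  have a': "1 + vec.representation (set ws) z' w = 1 / a"
    unfolding z'_def representation_linear(2)[OF ws z] using a by (simp add: a_def field_simps)
  \<comment> \<open>Passing from \<open>(z, a)\<close> to \<open>(- z / a, 1 / a)\<close> is an involution,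
    so one cancellation law gives both directions.\<close>
  have "- 1 / (1 / a) * (- 1 / a) = 1" using a by (simp flip: a_def)
  then have zz: "z = (- 1 / (1 / a)) *s z'"
    by (simp only: z'_def vec.scale_scale vec.scale_one)
  have closed: "add_multiple ws w u x \<in> V" if "u \<in> V" "x \<in> V" for u x
    using that V by (simp add: add_multiple_def vec.subspace_add vec.subspace_scale)
  have "add_multiple ws w z' (add_multiple ws w z x) = x" if "x \<in> V" for x
    unfolding z'_def using a by (intro add_multiple_cancel[OF ws z that]) (auto simp: a_def)
  moreover have "add_multiple ws w z (add_multiple ws w z' x) = x" if "x \<in> V" for x
    by (subst zz) (use a a' in \<open>intro add_multiple_cancel[OF ws z' that], auto simp: a_def\<close>)
  ultimately have "bij_betw (add_multiple ws w z) V V"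
    using closed z z' by (intro bij_betwI[where g = "add_multiple ws w z'"]) auto
  then show ?thesis
    by (auto simp: GL_def add_multiple_def representation_linear[OF ws] algebra_simps
        vec.scale_left_distrib vec.scale_right_distrib)
qed

text \<open>
  The defining bases of shears, scalings and phase rotations have the distinguished vector
  first, so a vector in another position is brought to the front.
\<close>

lemma basis_move_to_front:
  assumes "ordered_basis V ws" and "w \<in> set ws"
  shows "ordered_basis V (w # removeAll w ws)"
  using assms(2) ordered_basisD(1)[OF assms(1)]
  by (intro ordered_basis_cong_set[OF assms(1)]) (auto simp: distinct_removeAll)

lemma map_add_multiple_move_to_front:
  assumes "ordered_basis V ws" and "w \<in> set ws"
  shows "map (add_multiple ws w z) (w # removeAll w ws) = (w + z) # removeAll w ws"
  using assms by (auto simp: add_multiple_basis[OF assms(1)] intro!: map_idI)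

lemma complex_shear_add_multiple:
  assumes ws: "ordered_basis V ws" and w: "w \<in> set ws" and z: "z \<in> vec.span (set ws - {w})"
  shows "complex_shear V (add_multiple ws w z)"
proof -
  have "z \<in> V"
    using z vec.span_mono[of "set ws - {w}" "set ws"] ordered_basisD(3)[OF ws] by auto
  then have "add_multiple ws w z \<in> GL V"
    using representation_outside_eq_0[OF ws z] by (intro add_multiple_in_GL[OF ws]) auto
  moreover have "z \<in> vec.span (set (removeAll w ws))" using z by simp
  ultimately show ?thesis
    unfolding complex_shear_def
    by (intro conjI exI[of _ w] exI[of _ "removeAll w ws"] exI[of _ z])
      (rule basis_move_to_front[OF ws w] map_add_multiple_move_to_front[OF ws w] | assumption)+
qed

lemma add_multiple_self_in_GL:
  assumes ws: "ordered_basis V ws" and w: "w \<in> set ws" and c: "c \<noteq> 0"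
  shows "add_multiple ws w ((c - 1) *s w) \<in> GL V"
proof (rule add_multiple_in_GL[OF ws])
  have V: "w \<in> V" using ordered_basisD(5)[OF ws w] .
  show "(c - 1) *s w \<in> V" using vec.subspace_scale[OF ordered_basisD(4)[OF ws] V] .
  show "1 + vec.representation (set ws) ((c - 1) *s w) w \<noteq> 0"
    unfolding representation_linear(2)[OF ws V]
    using vec.representation_basis[OF ordered_basisD(2)[OF ws] w] c by simp
qed

lemma complex_line_scaling_add_multiple:
  assumes ws: "ordered_basis V ws" and w: "w \<in> set ws" and c: "c > 0"
  shows "complex_line_scaling V (add_multiple ws w ((complex_of_real c - 1) *s w))"
proof -
  have "w + (complex_of_real c - 1) *s w = complex_of_real c *s w"
    by (simp add: vec.scale_left_diff_distrib)
  then have "map (add_multiple ws w ((complex_of_real c - 1) *s w)) (w # removeAll w ws)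
      = (complex_of_real c *s w) # removeAll w ws"
    using map_add_multiple_move_to_front[OF ws w] by metis
  moreover have "add_multiple ws w ((complex_of_real c - 1) *s w) \<in> GL V"
    using c by (intro add_multiple_self_in_GL[OF ws w]) auto
  ultimately show ?thesis
    unfolding complex_line_scaling_def
    by (intro conjI exI[of _ w] exI[of _ "removeAll w ws"] exI[of _ c])
      (rule basis_move_to_front[OF ws w] c | assumption)+
qed

lemma basis_phase_rotation_add_multiple:
  assumes ws: "ordered_basis V ws" and j: "j < length ws" and \<phi>: "0 \<le> \<phi>" "\<phi> < 2 * pi"
  shows "basis_phase_rotation V ws j \<phi>
    (add_multiple ws (ws ! j) ((exp (\<i> * complex_of_real \<phi>) - 1) *s (ws ! j)))"
  unfolding basis_phase_rotation_def
proof (intro conjI)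
  show "map (add_multiple ws (ws ! j) ((exp (\<i> * complex_of_real \<phi>) - 1) *s (ws ! j))) ws
     = ws[j := exp (\<i> * complex_of_real \<phi>) *s (ws ! j)]"
    using ordered_basisD(1)[OF ws] j
    by (intro nth_equalityI)
      (auto simp: add_multiple_basis[OF ws] nth_list_update nth_eq_iff_index_eq
        vec.scale_left_diff_distrib)
  show "add_multiple ws (ws ! j) ((exp (\<i> * complex_of_real \<phi>) - 1) *s (ws ! j)) \<in> GL V"
    using j by (intro add_multiple_self_in_GL[OF ws]) auto
qed (use assms in auto)

lemma basis_phase_rotation_imp_phase_rotation:
  assumes R: "basis_phase_rotation V ws j \<phi> R"
  shows "phase_rotation V \<phi> R"
proof -
  have ws: "ordered_basis V ws" and j: "j < length ws"
    and m: "map R ws = ws[j := exp (\<i> * complex_of_real \<phi>) *s (ws ! j)]"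
    using R by (auto simp: basis_phase_rotation_def)
  have "R (ws ! i) = ws[j := exp (\<i> * complex_of_real \<phi>) *s (ws ! j)] ! i" if "i < length ws" for i
    using arg_cong[OF m, of "\<lambda>l. l ! i"] that by simp
  then have "map R (ws ! j # removeAll (ws ! j) ws)
      = (exp (\<i> * complex_of_real \<phi>) *s (ws ! j)) # removeAll (ws ! j) ws"
    using j by (auto simp: in_set_conv_nth intro!: map_idI) (metis nth_list_update_neq)
  then show ?thesis
    using R basis_move_to_front[OF ws, of "ws ! j"] j
    unfolding phase_rotation_def basis_phase_rotation_def by fastforce
qed

section \<open>Triangular automorphisms\<close>

text \<open>
  Upper triangularity with diagonal \<open>d\<close>, stated through the images of the basis vectors:
  columnwise constructions then need no matrix computations.
\<close>

definition triangular_wrt ::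
  "(complex ^ 'n) list \<Rightarrow> (complex ^ 'n \<Rightarrow> complex ^ 'n) \<Rightarrow> (nat \<Rightarrow> complex) \<Rightarrow> bool" where
  "triangular_wrt ws T d \<longleftrightarrow>
     (\<forall>k<length ws. T (ws ! k) - d k *s ws ! k \<in> vec.span (set (take k ws)))"

lemma span_take_subset:
  assumes ws: "ordered_basis V ws" and "k \<le> i" "i < length ws"
  shows "vec.span (set (take k ws)) \<subseteq> vec.span (set ws - {ws ! i})"
proof (rule vec.span_mono)
  show "set (take k ws) \<subseteq> set ws - {ws ! i}"
    using ordered_basisD(1)[OF ws] assms(2,3)
    by (auto simp: set_conv_nth nth_eq_iff_index_eq)
qed

lemma triangular_matrix_imp_triangular_wrt:
  assumes ws: "ordered_basis V ws" and T: "T \<in> GL V"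
    and tri: "upper_triangular (matrix_wrt ws T)"
  shows "triangular_wrt ws T ((!) (diag_mat (matrix_wrt ws T)))"
  unfolding triangular_wrt_def
proof (intro allI impI)
  fix k assume k: "k < length ws"
  define r where "r i = vec.representation (set ws) (T (ws ! k)) (ws ! i)" for i
  have r0: "r i = 0" if "k < i" "i < length ws" for i
    using upper_triangularD[OF tri, of k i] that k by (simp add: matrix_wrt_def r_def)
  have "T (ws ! k) \<in> V" using GL_closed[OF T] ordered_basisD(6)[OF ws k] .
  then have "T (ws ! k) = (\<Sum>i<length ws. r i *s ws ! i)"
    using representation_list[OF ws] by (simp add: r_def)
  also have "\<dots> = (\<Sum>i<Suc k. r i *s ws ! i)"
    using k r0 by (intro sum.mono_neutral_right) auto
  finally have "T (ws ! k) - r k *s ws ! k = (\<Sum>i<k. r i *s ws ! i)" by simp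
  also have "\<dots> \<in> vec.span (set (take k ws))"
    using k by (intro vec.span_sum vec.span_scale vec.span_base) (auto simp: in_set_conv_nth)
  finally show "T (ws ! k) - diag_mat (matrix_wrt ws T) ! k *s ws ! k
      \<in> vec.span (set (take k ws))"
    using k by (simp add: diag_mat_def matrix_wrt_def r_def)
qed

lemma det_on_triangular:
  assumes ws: "ordered_basis V ws" and T: "T \<in> GL V" and tri: "triangular_wrt ws T d"
  shows "det_on V T = (\<Prod>k<length ws. d k)"
proof -
  let ?n = "length ws"
  have entry: "matrix_wrt ws T $$ (i, k) = (if i = k then d k else 0)" if "k \<le> i" "i < ?n" for i k
  proof -
    have k: "k < ?n" using that by simp
    define u where "u = T (ws ! k) - d k *s ws ! k"
    have "u \<in> vec.span (set (take k ws))" using tri k by (simp add: triangular_wrt_def u_def)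
    then have u: "u \<in> vec.span (set ws - {ws ! i})" using span_take_subset[OF ws that] by auto
    then have uV: "u \<in> V"
      using vec.span_mono[of "set ws - {ws ! i}" "set ws"] ordered_basisD(3)[OF ws] by auto
    have wV: "ws ! k \<in> V" using ordered_basisD(6)[OF ws k] .
    have "T (ws ! k) = u + d k *s ws ! k" by (simp add: u_def)
    then have "vec.representation (set ws) (T (ws ! k)) (ws ! i) =
        d k * vec.representation (set ws) (ws ! k) (ws ! i)"
      using uV wV ordered_basisD(4)[OF ws] representation_outside_eq_0[OF ws u]
      by (simp add: representation_linear[OF ws] vec.subspace_scale)
    then show ?thesis
      using that k ordered_basisD[OF ws]
      by (auto simp: matrix_wrt_def vec.representation_basis nth_eq_iff_index_eq)
  qed
  have dim: "matrix_wrt ws T \<in> carrier_mat ?n ?n" by (simp add: matrix_wrt_def)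
  have "upper_triangular (matrix_wrt ws T)"
    using entry dim by (intro upper_triangularI) auto
  from det_upper_triangular[OF this dim]
  have "det_on V T = (\<Prod>k\<in>{0..<?n}. matrix_wrt ws T $$ (k, k))"
    using dim by (simp add: det_on_eq[OF ws T] prod_list_diag_prod)
  also have "\<dots> = (\<Prod>k<?n. d k)"
    by (intro prod.cong) (auto simp: entry)
  finally show ?thesis .
qed

text \<open>
  This is why the factors of the columnwise construction do not disturb earlier columns: the
  image of \<open>v\<^sub>k\<close> has no component along any later basis vector.
\<close>

lemma triangular_wrtD:
  assumes ws: "ordered_basis V ws" and tri: "triangular_wrt ws T d" and "k < i" "i < length ws"
  shows "vec.representation (set ws) (T (ws ! k)) (ws ! i) = 0"
proof -
  have "T (ws ! k) - d k *s ws ! k \<in> vec.span (set (take (Suc k) ws))"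
    using tri assms(3,4) vec.span_mono[of "set (take k ws)" "set (take (Suc k) ws)"]
    by (auto simp: triangular_wrt_def set_take_subset_set_take)
  moreover have "ws ! k \<in> set (take (Suc k) ws)"
    using assms(3,4) by (auto simp: in_set_conv_nth)
  ultimately have "T (ws ! k) \<in> vec.span (set (take (Suc k) ws))"
    by (metis vec.span_add vec.span_base vec.span_scale diff_add_cancel)
  then show ?thesis
    using span_take_subset[OF ws, of "Suc k" i] assms(3,4)
    by (intro representation_outside_eq_0[OF ws]) auto
qed

lemma triangular_wrt_scaled:
  assumes tri: "triangular_wrt ws T d" and T: "T \<in> GL V" and ws: "ordered_basis V ws"
    and D: "\<And>k. k < length ws \<Longrightarrow> D (ws ! k) = a k *s ws ! k"
  shows "triangular_wrt ws (T \<circ> D) (\<lambda>k. a k * d k)"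
  unfolding triangular_wrt_def
proof (intro allI impI)
  fix k assume k: "k < length ws"
  have "(T \<circ> D) (ws ! k) - (a k * d k) *s ws ! k = a k *s (T (ws ! k) - d k *s ws ! k)"
    using k D ordered_basisD(6)[OF ws k]
    by (simp add: GL_scale[OF T] vec.scale_right_diff_distrib)
  also have "\<dots> \<in> vec.span (set (take k ws))"
    using tri k unfolding triangular_wrt_def by (intro vec.span_scale) blast
  finally show "(T \<circ> D) (ws ! k) - (a k * d k) *s ws ! k \<in> vec.span (set (take k ws))" .
qed

section \<open>Compositions of shears and line scalings\<close>

abbreviation elementary :: "(complex ^ 'n) set \<Rightarrow> (complex ^ 'n \<Rightarrow> complex ^ 'n) \<Rightarrow> bool" where
  "elementary V g \<equiv> complex_shear V g \<or> complex_line_scaling V g"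

lemma elementary_in_GL: "elementary V g \<Longrightarrow> g \<in> GL V"
  by (auto simp: complex_shear_def complex_line_scaling_def)

text \<open>
  Without prescribed rotations, the multiset bookkeeping of the definition reduces to a list of
  elementary maps.
\<close>

lemma composed_Nil_iff:
  "composed_of_shears_scalings_and V [] T \<longleftrightarrow>
     (\<exists>fs. (\<forall>f\<in>set fs. elementary V f) \<and> (\<forall>x\<in>V. T x = foldr (\<circ>) fs id x))"
  unfolding composed_of_shears_scalings_and_def
  by (auto dest!: mset_eq_setD)

lemma composed_cong:
  "composed_of_shears_scalings_and V rs T \<Longrightarrow> (\<And>x. x \<in> V \<Longrightarrow> S x = T x) \<Longrightarrow>
    composed_of_shears_scalings_and V rs S"
  by (auto simp: composed_of_shears_scalings_and_def)

text \<open>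
  Rotations that are themselves elementary, such as those by the angle 0, can be counted among the
  shears and scalings.
\<close>

lemma composed_absorb:
  assumes "composed_of_shears_scalings_and V rs T" and "\<And>r. r \<in> set rs \<Longrightarrow> elementary V r"
  shows "composed_of_shears_scalings_and V [] T"
proof -
  obtain gs fs where "\<forall>g\<in>set gs. elementary V g" "mset fs = mset gs + mset rs"
    "\<forall>x\<in>V. T x = foldr (\<circ>) fs id x"
    using assms(1) by (auto simp: composed_of_shears_scalings_and_def)
  moreover from this(2) have "set fs = set gs \<union> set rs"
    by (metis mset_append mset_eq_setD set_append)
  ultimately show ?thesis using assms(2) unfolding composed_Nil_iff by blast
qed

lemma foldr_comp_append: "foldr (\<circ>) (fs @ gs) id = foldr (\<circ>) fs id \<circ> foldr (\<circ>) gs id"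
  by (induction fs) (auto simp: comp_assoc)

lemma composed_comp:
  assumes S: "composed_of_shears_scalings_and V [] S" and T: "composed_of_shears_scalings_and V rs T"
    and rs: "set rs \<subseteq> GL V"
  shows "composed_of_shears_scalings_and V rs (S \<circ> T)"
proof -
  obtain fs where fs: "\<forall>f\<in>set fs. elementary V f" "\<forall>x\<in>V. S x = foldr (\<circ>) fs id x"
    using S unfolding composed_Nil_iff by blast
  obtain hs gs where hs: "\<forall>h\<in>set hs. elementary V h" "mset gs = mset hs + mset rs"
    "\<forall>x\<in>V. T x = foldr (\<circ>) gs id x"
    using T by (auto simp: composed_of_shears_scalings_and_def)
  have "set gs = set hs \<union> set rs"
    using hs(2) by (metis mset_append mset_eq_setD set_append)
  then have "foldr (\<circ>) gs id \<in> GL V"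
    using hs(1) rs elementary_in_GL by (intro GL_foldr) blast
  then have "(S \<circ> T) x = foldr (\<circ>) (fs @ gs) id x" if "x \<in> V" for x
    using that fs(2) hs(3) GL_closed[of _ V x] by (simp add: foldr_comp_append del: foldr_append)
  then show ?thesis
    unfolding composed_of_shears_scalings_and_def using fs(1) hs(1,2)
    by (intro exI[of _ "fs @ hs"] exI[of _ "fs @ gs"]) auto
qed

lemma composed_single: "elementary V g \<Longrightarrow> composed_of_shears_scalings_and V [] g"
  unfolding composed_Nil_iff by (intro exI[of _ "[g]"]) auto

section \<open>Building a triangular automorphism column by column\<close>

text \<open>
  After \<open>m\<close> steps, the composition built so far agrees with \<open>T\<close> on the first \<open>m\<close> basis vectors and
  fixes the others. The next three factors are composed on the left and move only vectors with a
  nonzero component along the next basis vector \<open>w\<close>; among the current images of the basis,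
  \<open>w\<close> itself is the only such vector. Together they produce \<open>w \<mapsto> e w \<mapsto> c e w = \<lambda> w \<mapsto> \<lambda> (w + u / \<lambda>)\<close>.
\<close>

lemma triangular_composed_columnwise:
  assumes ws: "ordered_basis V ws" and T: "T \<in> GL V" and tri: "triangular_wrt ws T d"
    and d: "\<And>k. k < length ws \<Longrightarrow> d k \<noteq> 0"
  defines "R \<equiv> \<lambda>k. add_multiple ws (ws ! k) ((exp (\<i> * complex_of_real (Arg2pi (d k))) - 1) *s (ws ! k))"
  shows "composed_of_shears_scalings_and V (map R [0..<length ws]) T"
proof -
  let ?n = "length ws"
  let ?P = "\<lambda>m gs fs. (\<forall>g\<in>set gs. elementary V g) \<and> mset fs = mset gs + mset (map R [0..<m]) \<and>
      (\<forall>k<?n. foldr (\<circ>) fs id (ws ! k) = (if k < m then T (ws ! k) else ws ! k))"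
  have "\<exists>gs fs. ?P m gs fs" if "m \<le> ?n" for m
    using that
  proof (induction m)
    case 0
    show ?case by (intro exI[of _ "[]"]) auto
  next
    case (Suc m)
    then obtain gs fs where P: "?P m gs fs" by (meson Suc_leD)
    let ?w = "ws ! m"
    have m: "m < ?n" and w: "?w \<in> set ws" using Suc.prems by auto
    define e where "e = exp (\<i> * complex_of_real (Arg2pi (d m)))"
    define c where "c = norm (d m)"
    have c: "c > 0" and dm: "d m = complex_of_real c * e"
      using d[OF m] Arg2pi_eq[of "d m"] by (auto simp: c_def e_def)
    define u where "u = T ?w - d m *s ?w"
    have u: "u \<in> vec.span (set ws - {?w})"
      using tri m span_take_subset[OF ws order_refl m] by (auto simp: triangular_wrt_def u_def)
    define sc where "sc = add_multiple ws ?w ((complex_of_real c - 1) *s ?w)"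
    define sh where "sh = add_multiple ws ?w ((1 / d m) *s u)"
    have sc: "elementary V sc"
      unfolding sc_def using complex_line_scaling_add_multiple[OF ws w c] ..
    have sh: "elementary V sh"
      unfolding sh_def using complex_shear_add_multiple[OF ws w vec.span_scale[OF u]] ..
    have fix_other: "sh (sc (R m x)) = x" if "vec.representation (set ws) x ?w = 0" for x
      using that by (simp add: sh_def sc_def R_def add_multiple_def)
    have mult: "vec.representation (set ws) (a *s ?w) ?w = a" for a
      using ordered_basisD(2)[OF ws] w by (simp add: representation_linear(2)[OF ws ordered_basisD(5)[OF ws w]] vec.representation_basis)
    have "R m ?w = e *s ?w"
      using mult[of 1] by (simp add: R_def add_multiple_def e_def vec.scale_left_diff_distrib)
    moreover have "sc (e *s ?w) = d m *s ?w"
      unfolding sc_def add_multiple_def mult dm by (simp add: vec.scale_left_diff_distrib algebra_simps)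
    moreover have "sh (d m *s ?w) = T ?w"
      unfolding sh_def add_multiple_def mult using d[OF m] by (simp add: u_def)
    ultimately have new: "sh (sc (R m ?w)) = T ?w" by simp
    have "foldr (\<circ>) (sh # sc # R m # fs) id (ws ! k) = (if k < Suc m then T (ws ! k) else ws ! k)"
      if k: "k < ?n" for k
    proof -
      consider "k < m" | "k = m" | "m < k" by linarith
      then show ?thesis
      proof cases
        case 1
        then show ?thesis using P k triangular_wrtD[OF ws tri 1 m] fix_other by simp
      next
        case 2
        then show ?thesis using P k new by simp
      next
        case 3
        then have "vec.representation (set ws) (ws ! k) ?w = 0"
          using ordered_basisD(1,2)[OF ws] k m by (simp add: vec.representation_basis nth_eq_iff_index_eq)
        with 3 show ?thesis using P k fix_other by simp
      qed
    qed
    then have "?P (Suc m) (sh # sc # gs) (sh # sc # R m # fs)"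
      using P sc sh by auto
    then show ?case by blast
  qed
  from this[OF order_refl] obtain gs fs where P: "?P ?n gs fs" by blast
  have "R k \<in> GL V" if "k < ?n" for k
    unfolding R_def using that by (intro add_multiple_self_in_GL[OF ws]) auto
  moreover have "set fs = set gs \<union> set (map R [0..<?n])"
    using P by (metis mset_append mset_eq_setD set_append)
  ultimately have "foldr (\<circ>) fs id \<in> GL V"
    using P elementary_in_GL by (intro GL_foldr) fastforce
  moreover have "foldr (\<circ>) fs id w = T w" if "w \<in> set ws" for w
    using P that by (auto simp: in_set_conv_nth)
  ultimately have "T x = foldr (\<circ>) fs id x" if "x \<in> V" for x
    using GL_eqI[OF ws _ T _ that] by metis
  then show ?thesis
    unfolding composed_of_shears_scalings_and_def using P by blast
qed

text \<open>
  In the columnwise decomposition all phases are 0, and a rotation by 0 is the line scaling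
  by 1.
\<close>

lemma triangular_positive_diagonal_composed:
  assumes ws: "ordered_basis V ws" and T: "T \<in> GL V" and tri: "triangular_wrt ws T d"
    and pos: "\<And>k. k < length ws \<Longrightarrow> \<exists>r>0. d k = complex_of_real r"
  shows "composed_of_shears_scalings_and V [] T"
proof -
  have "d k \<noteq> 0" if "k < length ws" for k using pos[OF that] by auto
  note triangular_composed_columnwise[OF ws T tri this]
  then show ?thesis
  proof (rule composed_absorb)
    fix r
    assume "r \<in> set (map (\<lambda>k. add_multiple ws (ws ! k)
       ((exp (\<i> * complex_of_real (Arg2pi (d k))) - 1) *s ws ! k)) [0..<length ws])"
    then obtain k where k: "k < length ws" and r: "r = add_multiple ws (ws ! k)
       ((exp (\<i> * complex_of_real (Arg2pi (d k))) - 1) *s ws ! k)" by auto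
    have "exp (\<i> * complex_of_real (Arg2pi (d k))) = complex_of_real 1"
      using pos[OF k] by (auto simp: Arg2pi_of_real)
    then have "complex_line_scaling V r"
      unfolding r using complex_line_scaling_add_multiple[OF ws nth_mem[OF k], of 1] by simp
    then show "elementary V r" ..
  qed
qed

section \<open>Triangular automorphisms of positive determinant\<close>

text \<open>
  This is the factorisation of \<open>diag(\<mu>, 1 / \<mu>)\<close> into four unipotent triangular 2 by 2
  matrices. In the basis \<open>(v, w)\<close>, the product of \<open>L x\<close>, \<open>U y\<close>, \<open>L z\<close> and \<open>U t\<close> has upper row
  \<open>(1 + y z, t + y (1 + z t))\<close>. Choosing \<open>z = 1\<close> forces \<open>y = \<mu> - 1\<close> from the upper left entry, then
  \<open>t = (1 - \<mu>) / \<mu>\<close> from the vanishing of the upper right entry, and \<open>x = - 1 / \<mu>\<close> clears the lower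
  left entry. The remaining entry is \<open>1 / \<mu>\<close> because the determinant is 1.
\<close>

lemma reciprocal_scalings_composed:
  assumes ws: "ordered_basis V ws" and v: "v \<in> set ws" and w: "w \<in> set ws" and vw: "v \<noteq> w"
    and \<mu>: "\<mu> \<noteq> 0"
  obtains D where "D \<in> GL V" "composed_of_shears_scalings_and V [] D"
    "D v = \<mu> *s v" "D w = (1 / \<mu>) *s w" "\<And>x. x \<in> set ws \<Longrightarrow> x \<noteq> v \<Longrightarrow> x \<noteq> w \<Longrightarrow> D x = x"
proof
  define U where "U a = add_multiple ws w (a *s v)" for a
  define L where "L a = add_multiple ws v (a *s w)" for a
  define D where "D = L (- 1 / \<mu>) \<circ> (U (\<mu> - 1) \<circ> (L 1 \<circ> U ((1 - \<mu>) / \<mu>)))"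
  have "elementary V (U a)" for a
    unfolding U_def using v vw
    by (intro disjI1 complex_shear_add_multiple[OF ws w] vec.span_scale vec.span_base) auto
  moreover have "elementary V (L a)" for a
    unfolding L_def using w vw
    by (intro disjI1 complex_shear_add_multiple[OF ws v] vec.span_scale vec.span_base) auto
  ultimately show "D \<in> GL V" "composed_of_shears_scalings_and V [] D"
    unfolding D_def
    by (intro GL_comp elementary_in_GL composed_comp composed_single; simp)+
  have V: "vec.subspace V" "v \<in> V" "w \<in> V"
    using ordered_basisD[OF ws] v w by auto
  have rep: "vec.representation (set ws) (a *s v + b *s w) v = a"
    "vec.representation (set ws) (a *s v + b *s w) w = b" for a b
    using V v w vw ordered_basisD(2)[OF ws]
    by (simp_all add: representation_linear[OF ws] vec.subspace_scale vec.representation_basis)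
  have U: "U t (a *s v + b *s w) = (a + t * b) *s v + b *s w" for a b t
    by (simp add: U_def add_multiple_def rep vec.scale_left_distrib mult.commute)
  have L: "L t (a *s v + b *s w) = a *s v + (b + t * a) *s w" for a b t
    by (simp add: L_def add_multiple_def rep vec.scale_left_distrib mult.commute)
  have D: "D (a *s v + b *s w) = (\<mu> * a) *s v + (b / \<mu>) *s w" for a b
  proof -
    have "a + (1 - \<mu>) / \<mu> * b + (\<mu> - 1) * (b + 1 * (a + (1 - \<mu>) / \<mu> * b)) = \<mu> * a"
      using \<mu> by (simp add: field_simps)
    moreover have "b + 1 * (a + (1 - \<mu>) / \<mu> * b) + - 1 / \<mu> * (\<mu> * a) = b / \<mu>"
      using \<mu> by (simp add: field_simps)
    ultimately show ?thesis by (simp only: D_def comp_apply U L)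
  qed
  show "D v = \<mu> *s v" using D[of 1 0] by simp
  show "D w = (1 / \<mu>) *s w" using D[of 0 1] by simp
  show "D x = x" if "x \<in> set ws" "x \<noteq> v" "x \<noteq> w" for x
    using that ordered_basisD(2)[OF ws]
    by (simp add: D_def U_def L_def add_multiple_def vec.representation_basis)
qed

text \<open>
  Induction on the last position at which the diagonal may fail to be positive. The entry
  \<open>\<mu>\<close> at this position is absorbed into position 0 by precomposing with the map \<open>E\<close> that divides the basis
  vector there by \<open>\<mu>\<close> and multiplies the first one by \<open>\<mu>\<close>; this preserves triangularity and the
  product of the diagonal. The inverse \<open>D\<close> of \<open>E\<close> is a composition of shears, so \<open>T\<close> is
  recovered from \<open>T \<circ> E\<close>. Once all positions but 0 are positive, so is position 0, being a
  quotient of positive numbers.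
\<close>

lemma triangular_positive_det_composed:
  assumes ws: "ordered_basis V ws" and T: "T \<in> GL V" and tri: "triangular_wrt ws T d"
    and det: "(\<Prod>k<length ws. d k) = complex_of_real r" "r > 0"
  shows "composed_of_shears_scalings_and V [] T"
proof -
  let ?n = "length ws"
  let ?pos = "\<lambda>z. \<exists>r>0. z = complex_of_real r"
  have "composed_of_shears_scalings_and V [] T"
    if "T \<in> GL V" "triangular_wrt ws T d" "(\<Prod>k<?n. d k) = complex_of_real r"
      "\<And>k. m < k \<Longrightarrow> k < ?n \<Longrightarrow> ?pos (d k)" for m T d
    using that
  proof (induction m arbitrary: T d)
    case 0
    show ?case
    proof (rule triangular_positive_diagonal_composed[OF ws 0(1,2)])
      fix k assume k: "k < ?n"
      show "?pos (d k)"
      proof (cases "k = 0")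
        case True
        have "\<forall>j\<in>{1..<?n}. \<exists>r>0. d j = complex_of_real r" using 0(4) by auto
        then obtain s where s: "\<forall>j\<in>{1..<?n}. s j > 0 \<and> d j = complex_of_real (s j)"
          by metis
        define p where "p = (\<Prod>j\<in>{1..<?n}. s j)"
        have p: "p > 0" unfolding p_def using s by (intro prod_pos) auto
        have "{..<?n} = insert 0 {1..<?n}" using k True by auto
        then have "complex_of_real r = d 0 * (\<Prod>j\<in>{1..<?n}. d j)"
          using 0(3) by simp
        also have "(\<Prod>j\<in>{1..<?n}. d j) = complex_of_real p"
          unfolding p_def using s by simp
        finally have "d 0 = complex_of_real (r / p)" using p by simp
        then show ?thesis using True det(2) p by (metis divide_pos_pos)
      qed (use 0(4) k in auto)
    qed
  next
    case (Suc m)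
    show ?case
    proof (cases "Suc m < ?n")
      case False
      then show ?thesis using Suc by (metis Suc_lessI)
    next
      case True
      let ?\<mu> = "d (Suc m)"
      have nz: "?\<mu> \<noteq> 0"
      proof
        assume "?\<mu> = 0"
        then have "(\<Prod>k<?n. d k) = 0" using True by (intro prod_zero) auto
        then show False using Suc.prems(3) det(2) by simp
      qed
      let ?v = "ws ! Suc m" and ?w = "ws ! 0"
      have "ws \<noteq> []" using True by auto
      then have vw: "?v \<in> set ws" "?w \<in> set ws" "?v \<noteq> ?w"
        using True nth_eq_iff_index_eq[OF ordered_basisD(1)[OF ws], of "Suc m" 0]
        by (auto intro!: nth_mem)
      obtain D where D: "D \<in> GL V" "composed_of_shears_scalings_and V [] D"
        "D ?v = ?\<mu> *s ?v" "D ?w = (1 / ?\<mu>) *s ?w"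
        "\<And>x. x \<in> set ws \<Longrightarrow> x \<noteq> ?v \<Longrightarrow> x \<noteq> ?w \<Longrightarrow> D x = x"
        using reciprocal_scalings_composed[OF ws vw nz] by metis
      have "1 / ?\<mu> \<noteq> 0" using nz by simp
      from reciprocal_scalings_composed[OF ws vw this]
      obtain E where E: "E \<in> GL V" "E ?v = (1 / ?\<mu>) *s ?v" "E ?w = (1 / (1 / ?\<mu>)) *s ?w"
        "\<And>x. x \<in> set ws \<Longrightarrow> x \<noteq> ?v \<Longrightarrow> x \<noteq> ?w \<Longrightarrow> E x = x"
        by metis
      define a where "a k = (if k = Suc m then 1 / ?\<mu> else if k = 0 then ?\<mu> else 1)" for k
      have Ea: "E (ws ! k) = a k *s ws ! k" if "k < ?n" for k
        using E(2,3) E(4)[of "ws ! k"] that True \<open>ws \<noteq> []\<close>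
          nth_eq_iff_index_eq[OF ordered_basisD(1)[OF ws], of k "Suc m"]
          nth_eq_iff_index_eq[OF ordered_basisD(1)[OF ws], of k 0]
        by (auto simp: a_def)
      have "(\<Prod>k<?n. a k) = (\<Prod>k\<in>{0, Suc m}. a k)"
        using True by (intro prod.mono_neutral_right) (auto simp: a_def)
      also have "\<dots> = 1" using nz by (simp add: a_def)
      finally have prod: "(\<Prod>k<?n. a k * d k) = complex_of_real r"
        using Suc.prems(3) by (simp add: prod.distrib)
      have "?pos (a k * d k)" if "m < k" "k < ?n" for k
        using Suc.prems(4)[of k] that nz by (cases "k = Suc m") (auto simp: a_def intro: exI[of _ 1])
      from Suc.IH[OF GL_comp[OF Suc.prems(1) E(1)]
          triangular_wrt_scaled[OF Suc.prems(2,1) ws Ea] prod this]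
      have "composed_of_shears_scalings_and V [] (T \<circ> E)" .
      from composed_comp[OF this D(2)]
      have TED: "composed_of_shears_scalings_and V [] (T \<circ> E \<circ> D)" by (simp add: comp_def)
      have "E (D x) = x" if "x \<in> set ws" for x
      proof -
        have V: "?v \<in> V" "?w \<in> V" using vw ordered_basisD(5)[OF ws] by auto
        consider "x = ?v" | "x = ?w" | "x \<noteq> ?v" "x \<noteq> ?w" by blast
        then show ?thesis
          using D E V nz that by cases (auto simp: GL_scale[OF E(1)])
      qed
      then have "(E \<circ> D) x = id x" if "x \<in> V" for x
        using GL_eqI[OF ws GL_comp[OF E(1) D(1)] id_in_GL _ that] by simp
      then show ?thesis by (intro composed_cong[OF TED]) simp
    qed
  qed
  from this[OF T tri det(1), of ?n] show ?thesis by simp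
qed

section \<open>Positivity of the determinant of a composition\<close>

text \<open>
  Listing the distinguished vector last, a shear or scaling becomes upper triangular: its only
  non-trivial column is the last one.
\<close>

lemma det_on_elementary_pos:
  assumes "elementary V g"
  shows "\<exists>r>0. det_on V g = complex_of_real r"
proof -
  have last: "det_on V g = d"
    if g: "g \<in> GL V" and b: "ordered_basis V (w # ws)" and u: "u \<in> vec.span (set ws)"
      and map: "map g (w # ws) = (d *s w + u) # ws" for w ws u d
  proof -
    have b': "ordered_basis V (ws @ [w])"
      using ordered_basisD(1)[OF b] by (intro ordered_basis_cong_set[OF b]) auto
    have gx: "g x = x" if "x \<in> set ws" for x
      using map that by (auto simp: map_eq_conv[of g ws id, simplified])
    have "triangular_wrt (ws @ [w]) g (\<lambda>k. if k = length ws then d else 1)"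
      using map u gx by (auto simp: triangular_wrt_def nth_append vec.span_zero)
    from det_on_triangular[OF b' g this] show ?thesis by simp
  qed
  from assms show ?thesis
  proof
    assume "complex_shear V g"
    then obtain w ws u where "g \<in> GL V" "ordered_basis V (w # ws)" "u \<in> vec.span (set ws)"
      "map g (w # ws) = (1 *s w + u) # ws" unfolding complex_shear_def by auto
    from last[OF this] show ?thesis by (intro exI[of _ 1]) simp
  next
    assume "complex_line_scaling V g"
    then obtain w ws c where c: "c > 0" and *: "g \<in> GL V" "ordered_basis V (w # ws)"
      "map g (w # ws) = (complex_of_real c *s w + 0) # ws" unfolding complex_line_scaling_def by auto
    from last[OF *(1,2) vec.span_zero *(3)] c show ?thesis by blast
  qed
qed

lemma det_on_composed_pos:
  assumes V: "vec.subspace V" and T: "composed_of_shears_scalings_and V [] T"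
  shows "\<exists>r>0. det_on V T = complex_of_real r"
proof -
  obtain fs where fs: "\<forall>f\<in>set fs. elementary V f" "\<forall>x\<in>V. T x = foldr (\<circ>) fs id x"
    using T unfolding composed_Nil_iff by blast
  have "\<exists>r>0. det_on V (foldr (\<circ>) fs id) = complex_of_real r"
    using fs(1)
  proof (induction fs)
    case Nil
    show ?case using det_on_id[OF V] by (intro exI[of _ 1]) (simp add: id_def)
  next
    case (Cons f fs)
    then obtain r s where "r > 0" "s > 0" "det_on V f = complex_of_real r"
      "det_on V (foldr (\<circ>) fs id) = complex_of_real s"
      using det_on_elementary_pos[of V f] by (metis list.set_intros)
    moreover have "f \<in> GL V" "foldr (\<circ>) fs id \<in> GL V"
      using Cons.prems elementary_in_GL by (auto intro!: GL_foldr)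
    ultimately have "det_on V (foldr (\<circ>) (f # fs) id) = complex_of_real (r * s)"
      by (simp add: det_on_comp[OF V])
    then show ?case using \<open>r > 0\<close> \<open>s > 0\<close> mult_pos_pos by blast
  qed
  then show ?thesis using det_on_cong[OF V] fs(2) by metis
qed

section \<open>Decomposition of an automorphism in Jordan form\<close>

text \<open>
  On the unit circle, \<open>cis\<close> turns sums of angles into products and has period \<open>2\<pi>\<close>.
\<close>

lemma Arg2pi_prod_rcong:
  assumes "finite I" and "\<And>i. i \<in> I \<Longrightarrow> z i \<noteq> 0"
  shows "[Arg2pi (\<Prod>i\<in>I. z i) = (\<Sum>i\<in>I. Arg2pi (z i))] (rmod 2 * pi)"
proof -
  have cis: "cis (Arg2pi x) = sgn x" if "x \<noteq> 0" for x
    using Arg2pi_eq[of x] that by (simp add: cis_conv_exp sgn_eq mult.commute field_simps)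
  have "cis (Arg2pi (\<Prod>i\<in>I. z i)) = (\<Prod>i\<in>I. sgn (z i))"
    using assms by (simp add: cis sgn_eq prod_dividef flip: prod_norm)
  also have "\<dots> = (\<Prod>i\<in>I. cis (Arg2pi (z i)))"
    using assms cis by (intro prod.cong) auto
  also have "\<dots> = cis (\<Sum>i\<in>I. Arg2pi (z i))"
    using assms(1) by (induction I) (auto simp: cis_mult)
  finally show ?thesis by (simp add: cis_eq_iff)
qed

theorem theorem3p6:
  fixes V :: "(complex ^ 'n) set"
    and T :: "complex ^ 'n \<Rightarrow> complex ^ 'n"
    and \<beta> :: "(complex ^ 'n) list"
    and \<Lambda> :: "complex list"
  assumes "vec.subspace V"
    and "T \<in> GL V"
    and "jordan_basis V T \<beta>"
    and "\<Lambda> = diag_mat (matrix_wrt \<beta> T)"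
  shows "((\<exists>rs. length rs = length \<beta> \<and>
             (\<forall>j<length \<beta>. basis_phase_rotation V \<beta> j (Arg2pi (\<Lambda> ! j)) (rs ! j)) \<and>
             composed_of_shears_scalings_and V rs T) \<and>
          [Arg2pi (det_on V T) = (\<Sum>j<length \<beta>. Arg2pi (\<Lambda> ! j))] (rmod 2 * pi))
       \<and> (V \<noteq> {0} \<longrightarrow>
           (\<exists>R. phase_rotation V (Arg2pi (det_on V T)) R \<and>
              composed_of_shears_scalings_and V [R] T))
       \<and> (T \<in> GL_plus V \<longleftrightarrow> composed_of_shears_scalings_and V [] T)"
proof -
  note V = assms(1) and T = assms(2)
  let ?n = "length \<beta>"
  have \<beta>: "ordered_basis V \<beta>" using assms(3) by (simp add: jordan_basis_def)
  obtain n_as where jm: "matrix_wrt \<beta> T = jordan_matrix n_as"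
    using assms(3) by (auto simp: jordan_basis_def)
  have "upper_triangular (matrix_wrt \<beta> T)"
    unfolding jm by (intro upper_triangularI jordan_matrix_upper_triangular) auto
  then have tri: "triangular_wrt \<beta> T ((!) \<Lambda>)"
    using triangular_matrix_imp_triangular_wrt[OF \<beta> T] assms(4) by simp
  have det: "det_on V T = (\<Prod>k<?n. \<Lambda> ! k)" using det_on_triangular[OF \<beta> T tri] .
  have nz: "\<Lambda> ! k \<noteq> 0" if "k < ?n" for k
    using det_on_nonzero[OF V T] that by (auto simp: det)

  define rot where "rot k = add_multiple \<beta> (\<beta> ! k)
    ((exp (\<i> * complex_of_real (Arg2pi (\<Lambda> ! k))) - 1) *s \<beta> ! k)" for k
  have "composed_of_shears_scalings_and V (map rot [0..<?n]) T"
    using triangular_composed_columnwise[OF \<beta> T tri nz] by (simp only: rot_def[abs_def])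
  moreover have "basis_phase_rotation V \<beta> j (Arg2pi (\<Lambda> ! j)) (rot j)" if "j < ?n" for j
    unfolding rot_def using that
    by (intro basis_phase_rotation_add_multiple[OF \<beta>] Arg2pi_ge_0 Arg2pi_lt_2pi)
  ultimately have part1: "\<exists>rs. length rs = ?n \<and>
      (\<forall>j<?n. basis_phase_rotation V \<beta> j (Arg2pi (\<Lambda> ! j)) (rs ! j)) \<and>
      composed_of_shears_scalings_and V rs T"
    by (intro exI[of _ "map rot [0..<?n]"]) auto
  have arg: "[Arg2pi (det_on V T) = (\<Sum>j<?n. Arg2pi (\<Lambda> ! j))] (rmod 2 * pi)"
    unfolding det using nz by (intro Arg2pi_prod_rcong) auto
  have part2: "\<exists>R. phase_rotation V (Arg2pi (det_on V T)) R \<and> composed_of_shears_scalings_and V [R] T"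
    if "V \<noteq> {0}"
  proof -
    have n: "0 < ?n" using that ordered_basisD(3)[OF \<beta>] by auto
    let ?w = "\<beta> ! 0"
    define e where "e = exp (\<i> * complex_of_real (Arg2pi (det_on V T)))"
    have e: "e \<noteq> 0" by (simp add: e_def)
    \<comment> \<open>\<open>R'\<close> inverts \<open>R\<close> on \<open>V\<close>; precomposing with it divides the first diagonal entry,
      and hence the determinant, by \<open>e\<close>.\<close>
    define R where "R = add_multiple \<beta> ?w ((e - 1) *s ?w)"
    define R' where "R' = add_multiple \<beta> ?w ((1 / e - 1) *s ?w)"
    have R: "basis_phase_rotation V \<beta> 0 (Arg2pi (det_on V T)) R"
      unfolding R_def e_def by (intro basis_phase_rotation_add_multiple[OF \<beta> n] Arg2pi_ge_0 Arg2pi_lt_2pi)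
    have RGL: "R \<in> GL V" "R' \<in> GL V"
      unfolding R_def R'_def using e n by (intro add_multiple_self_in_GL[OF \<beta>]; simp)+
    have Rw: "R x = (if x = ?w then e *s x else x)" "R' x = (if x = ?w then (1 / e) *s x else x)"
      if "x \<in> set \<beta>" for x
      unfolding R_def R'_def add_multiple_basis[OF \<beta> that] by (simp_all add: vec.scale_left_diff_distrib)
    define a where "a k = (if k = 0 then 1 / e else 1)" for k :: nat
    have "R' (\<beta> ! k) = a k *s \<beta> ! k" if "k < ?n" for k
      using Rw(2)[of "\<beta> ! k"] that n ordered_basisD(1)[OF \<beta>] by (simp add: a_def nth_eq_iff_index_eq)
    from triangular_wrt_scaled[OF tri T \<beta> this]
    have tri': "triangular_wrt \<beta> (T \<circ> R') (\<lambda>k. a k * \<Lambda> ! k)" .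
    have "(\<Prod>k<?n. a k) = 1 / e" using n by (simp add: a_def prod.delta)
    then have "(\<Prod>k<?n. a k * \<Lambda> ! k) = det_on V T / e" by (simp add: prod.distrib det)
    also have "\<dots> = complex_of_real (norm (det_on V T))"
      using Arg2pi_eq[of "det_on V T"] e by (simp add: e_def field_simps)
    finally have TR': "composed_of_shears_scalings_and V [] (T \<circ> R')"
      using triangular_positive_det_composed[OF \<beta> GL_comp[OF T RGL(2)] tri'] det_on_nonzero[OF V T]
      by simp
    have "composed_of_shears_scalings_and V [R] R"
      unfolding composed_of_shears_scalings_and_def
      by (intro exI[of _ "[]"] exI[of _ "[R]"]) auto
    from composed_comp[OF TR' this]
    have TRR: "composed_of_shears_scalings_and V [R] (T \<circ> R' \<circ> R)" using RGL by simp
    have "(R' \<circ> R) x = id x" if "x \<in> set \<beta>" for x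
      using Rw that e ordered_basisD(5)[OF \<beta> that] by (auto simp: GL_scale[OF RGL(2)])
    then have "(R' \<circ> R) x = id x" if "x \<in> V" for x
      using GL_eqI[OF \<beta> GL_comp[OF RGL(2,1)] id_in_GL _ that] by simp
    then have "composed_of_shears_scalings_and V [R] T"
      by (intro composed_cong[OF TRR]) simp
    with basis_phase_rotation_imp_phase_rotation[OF R] show ?thesis by blast
  qed
  have "T \<in> GL_plus V \<longleftrightarrow> composed_of_shears_scalings_and V [] T"
    using triangular_positive_det_composed[OF \<beta> T tri] det_on_composed_pos[OF V, of T] T det
    unfolding GL_plus_def by auto
  with part1 arg part2 show ?thesis by blast
qed

end
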